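(* For all complex values of the parameters $b,c,f$ such that both sides make sense, the following product formula holds: $$ \left[{}_{3}F_{2}\!\left(\begin{matrix}c,\;b,\;f+1\\c+b+3/2,\;f\end{matrix}\,\bigg\vert\,x\right)\right]^2={}_{6}F_{5}\!\left(\begin{matrix}2c,\;2b,\;c+b,\;\lambda_1+1,\;\lambda_2+1,\;\lambda_3+1\\c+b+3/2,\;2c+2b+2,\;\lambda_1,\;\lambda_2,\;\lambda_3\end{matrix}\,\bigg\vert\,x\right), $$ where $\lambda_1,\lambda_2,\lambda_3$ are the roots of the polynomial of degree $3$ $$ P_3(t)=f(f-t)\big(t^2-(8cb+4c+4b+1)t+2(2c+1)(2b+1)(c+b)\big)+2cb\,t(t+1)(c+b-t+1/2). $$
   Context: ${}_pF_q(a_1,\ldots,a_p;b_1,\ldots,b_q;x)=\sum_{k\ge0}\frac{(a_1)_k\cdots(a_p)_k}{(b_1)_k\cdots(b_q)_k\,k!}x^k$ is the generalized hypergeometric series, with $(a)_k=a(a+1)\cdots(a+k-1)$. The roots are listed with multiplicity. "Both sides make sense" means that no denominator occurring in the expressions vanishes (and $P_3$ has degree exactly $3$); the identity is between power series in $x$. *)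

theory Defs
  imports "HOL-Computational_Algebra.Computational_Algebra"
begin

text \<open>
  The generalized hypergeometric series with upper parameters \<open>as\<close>, lower parameters \<open>bs\<close>
  and argument \<open>x\<close>, as a formal power series in \<open>x\<close>, is \<open>fps_hypergeo as bs 1\<close>.
  Since division by zero yields zero in HOL, the well-definedness of all its coefficients has to be
  stated separately.
\<close>

definition hypergeo_defined :: "'a::field_char_0 list \<Rightarrow> bool" where
  "hypergeo_defined bs \<longleftrightarrow> (\<forall>b\<in>set bs. \<forall>k. pochhammer b k \<noteq> 0)"

text \<open>In the following polynomial the indeterminate \<open>t\<close> is \<open>[:0, 1:]\<close>.\<close>

definition P3 :: "complex \<Rightarrow> complex \<Rightarrow> complex \<Rightarrow> complex poly" where
  "P3 b c f = (let t = [:0, 1:] in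
     [:f:] * ([:f:] - t) *
       (t^2 - [:8*c*b + 4*c + 4*b + 1:] * t + [:2 * (2*c + 1) * (2*b + 1) * (c + b):])
     + [:2*c*b:] * t * (t + 1) * ([:c + b:] - t + [:1/2:]))"

lemma poly_P3:
  "poly (P3 b c f) t =
     f * (f - t) *
       (t^2 - (8*c*b + 4*c + 4*b + 1) * t + 2 * (2*c + 1) * (2*b + 1) * (c + b))
     + 2*c*b * t * (t + 1) * (c + b - t + 1/2)"
  by (simp add: P3_def Let_def) algebra

end

theory Submission
  imports Defs
begin

text \<open>
  Since \<open>(f + 1)\<^sub>k / (f)\<^sub>k = (f + k) / f\<close>, the left-hand side is \<open>(F + \<theta> F / f)\<^sup>2\<close>, where
  \<open>\<theta> = x d/dx\<close> and \<open>F\<close> is the series \<open>\<^sub>2F\<^sub>1(b, c; b + c + 3/2; x)\<close>. So it is determined by the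
  coefficients of \<open>F\<^sup>2\<close> and \<open>(\<theta> F)\<^sup>2\<close>. The hypergeometric equation for \<open>F\<close> gives coupled first-order
  recurrences for these coefficients, and their solution in closed form is read off from the
  coefficients of \<open>P\<^sub>3\<close> as a polynomial in \<open>f\<close>.
\<close>

definition fps_theta :: "'a::comm_semiring_1 fps \<Rightarrow> 'a fps" where
  "fps_theta F = fps_X * fps_deriv F"

lemma fps_nth_theta [simp]: "fps_nth (fps_theta F) n = of_nat n * fps_nth F n"
  by (cases n) (simp_all add: fps_theta_def)

lemma fps_theta_mult: "fps_theta (F * G) = fps_theta F * G + F * fps_theta G"
  for F G :: "'a::comm_ring_1 fps"
  by (simp add: fps_theta_def algebra_simps)

text \<open>This is the hypergeometric equation \<open>\<theta> (\<theta> + g - 1) F = x (\<theta> +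
  b) (\<theta> + c) F\<close> multiplied out. As \<open>\<theta>\<close> multiplies the n-th
  coefficient by n, it amounts to the ratio of consecutive coefficients of \<open>F\<close>.\<close>

lemma hypergeo_2F1_theta_eq:
  fixes b c g :: "'a::field_char_0"
  assumes "\<And>k. pochhammer g k \<noteq> 0"
  defines "F \<equiv> fps_hypergeo [b, c] [g] 1"
  shows "fps_theta (fps_theta F) + fps_const (g - 1) * fps_theta F =
    fps_X * (fps_theta (fps_theta F) + fps_const (b + c) * fps_theta F + fps_const (b * c) * F)"
proof (rule fps_ext)
  fix n
  show "fps_nth (fps_theta (fps_theta F) + fps_const (g - 1) * fps_theta F) n =
    fps_nth (fps_X * (fps_theta (fps_theta F) + fps_const (b + c) * fps_theta F + fps_const (b * c) * F)) n"
  proof (cases n)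
    case 0
    then show ?thesis by simp
  next
    case (Suc m)
    have "g + of_nat m \<noteq> 0"
      using assms(1)[of "Suc m"] by (simp add: pochhammer_Suc)
    moreover have "(1 + of_nat m :: 'a) \<noteq> 0"
      by (metis of_nat_Suc of_nat_neq_0)
    moreover have "fps_nth F (Suc m) =
        (b + of_nat m) * (c + of_nat m) / ((g + of_nat m) * (1 + of_nat m)) * fps_nth F m"
      by (simp add: F_def fps_hypergeo_def pochhammer_Suc mult_ac)
    ultimately have rec: "(1 + of_nat m) * (g + of_nat m) * fps_nth F (Suc m) =
        (b + of_nat m) * (c + of_nat m) * fps_nth F m"
      by simp
    show ?thesis
      using rec by (simp add: Suc) algebra
  qed
qed

text \<open>The equation times \<open>2 * \<theta> F\<close>, and times \<open>2 * F\<close>,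
  involves only \<open>F\<^sup>2\<close>, \<open>(\<theta> F)\<^sup>2\<close> and their images under
  \<open>\<theta>\<close>, so comparing coefficients gives a closed system for \<open>u\<close> and
  \<open>w\<close>.\<close>

lemma fps_theta_square_recurrences:
  fixes F :: "'a::field_char_0 fps"
  assumes ode: "fps_theta (fps_theta F) + fps_const (g - 1) * fps_theta F =
    fps_X * (fps_theta (fps_theta F) + fps_const s * fps_theta F + fps_const p * F)"
  defines "u \<equiv> fps_nth (F\<^sup>2)" and "w \<equiv> fps_nth ((fps_theta F)\<^sup>2)"
  shows "(of_nat n + 2 * g - 1) * w (Suc n) = (of_nat n + 2 * s) * w n + p * of_nat n * u n"
    and "(of_nat n + g) * of_nat (Suc n) * u (Suc n) =
      (of_nat n + s) * of_nat n * u n + 2 * (w (Suc n) - w n + p * u n)"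
proof -
  define G where "G = fps_theta F"
  define H where "H = fps_theta G"
  have ode': "H = fps_X * (H + fps_const s * G + fps_const p * F) - fps_const (g - 1) * G"
    using ode by (simp add: G_def H_def algebra_simps)
  have u': "fps_theta (F\<^sup>2) = 2 * (F * G)"
    by (simp add: power2_eq_square fps_theta_mult G_def)
  have w': "fps_theta (G\<^sup>2) = 2 * (G * H)"
    by (simp add: power2_eq_square fps_theta_mult H_def)
  have v': "fps_theta (F * G) = G\<^sup>2 + F * H"
    by (simp add: power2_eq_square fps_theta_mult H_def G_def)
  \<comment> \<open>The equation times \<open>2 * G\<close>; the mixed product
    \<open>2 * (F * G)\<close> is \<open>fps_theta (F\<^sup>2)\<close>.\<close>
  have "fps_theta (G\<^sup>2) + 2 * (fps_const (g - 1) * G\<^sup>2) =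
      fps_X * (fps_theta (G\<^sup>2) + 2 * (fps_const s * G\<^sup>2) + fps_const p * fps_theta (F\<^sup>2))"
    unfolding w' u' using ode' by algebra
  from arg_cong[OF this, of "\<lambda>A. fps_nth A (Suc n)"]
  show "(of_nat n + 2 * g - 1) * w (Suc n) = (of_nat n + 2 * s) * w n + p * of_nat n * u n"
    by (simp add: u_def w_def G_def algebra_simps fps_numeral_fps_const)
  \<comment> \<open>The equation times \<open>2 * F\<close>; here \<open>2 * (F * H)\<close> is the
    second \<open>\<theta>\<close>-derivative of \<open>F\<^sup>2\<close> minus
    \<open>2 * G\<^sup>2\<close>.\<close>
  have "fps_theta (fps_theta (F\<^sup>2)) + fps_const (g - 1) * fps_theta (F\<^sup>2) - 2 * G\<^sup>2 =
      fps_X * (fps_theta (fps_theta (F\<^sup>2)) + fps_const s * fps_theta (F\<^sup>2) - 2 * G\<^sup>2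
        + 2 * fps_const p * F\<^sup>2)"
  proof -
    have "fps_theta (fps_theta (F\<^sup>2)) = 2 * (G\<^sup>2 + F * H)"
      unfolding u' v'[symmetric] by (rule fps_ext) (simp add: fps_numeral_fps_const)
    then show ?thesis
      unfolding u' using ode' by (simp, algebra)
  qed
  from arg_cong[OF this, of "\<lambda>A. fps_nth A (Suc n)"]
  show "(of_nat n + g) * of_nat (Suc n) * u (Suc n) =
      (of_nat n + s) * of_nat n * u n + 2 * (w (Suc n) - w n + p * u n)"
    by (simp add: u_def w_def G_def algebra_simps fps_numeral_fps_const flip: mult_2)
qed

text \<open>At \<open>t = -n\<close>, \<open>P3\<close> equals \<open>f * (f + n) * Q n\<close> plus
  a term free of \<open>f\<close>; these two parts are the closed forms for \<open>F\<^sup>2\<close>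
  and \<open>(\<theta> F)\<^sup>2\<close>. \<open>T\<close> is the right-hand side of the theorem
  without the pairs \<open>\<lambda> + 1\<close>, \<open>\<lambda>\<close>. The factor
  \<open>Q 0\<close> normalises the value at n = 0 without a division, so the case
  \<open>Q 0 = 0\<close> is covered.\<close>

lemma hypergeo_2F1_squares:
  fixes b c :: "'a::field_char_0"
  assumes "\<And>k. pochhammer (c + b + 3/2) k \<noteq> 0"
    and "\<And>k. pochhammer (2 * c + 2 * b + 2) k \<noteq> 0"
  defines "F \<equiv> fps_hypergeo [b, c] [c + b + 3/2] 1"
    and "T \<equiv> fps_nth (fps_hypergeo [2 * c, 2 * b, c + b] [c + b + 3/2, 2 * c + 2 * b + 2] 1)"
    and "Q \<equiv> (\<lambda>n. n\<^sup>2 + (8 * c * b + 4 * c + 4 * b + 1) * n + 2 * (2 * c + 1) * (2 * b + 1) * (c + b))"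
  shows "Q 0 * fps_nth (F\<^sup>2) n = T n * Q (of_nat n)"
    and "Q 0 * fps_nth ((fps_theta F)\<^sup>2) n =
      T n * (2 * c * b * of_nat n * (of_nat n - 1) * (c + b + of_nat n + 1/2))"
proof -
  define u where "u = fps_nth (F\<^sup>2)"
  define w where "w = fps_nth ((fps_theta F)\<^sup>2)"
  note rec = fps_theta_square_recurrences[OF hypergeo_2F1_theta_eq[of _ b c, OF assms(1)],
    folded F_def, folded u_def w_def]
  \<comment> \<open>Joint induction: \<open>w (Suc n)\<close> depends on \<open>u n\<close> and
    \<open>w n\<close>, and \<open>u (Suc n)\<close> depends in addition on
    \<open>w (Suc n)\<close>.\<close>
  have "Q 0 * u n = T n * Q (of_nat n) \<and>
    Q 0 * w n = T n * (2 * c * b * of_nat n * (of_nat n - 1) * (c + b + of_nat n + 1/2))"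
  proof (induction n)
    case 0
    show ?case
      by (simp add: u_def w_def F_def T_def fps_hypergeo_def power2_eq_square)
  next
    case (Suc n)
    define x :: 'a where "x = of_nat n"
    \<comment> \<open>The ratio \<open>T (Suc n) / T n\<close> is
      \<open>A / (g * B * (x + 1))\<close>. Since \<open>g = h + 1\<close>, the closed form of
      \<open>w\<close> has \<open>h\<close> at n and \<open>g\<close> at n + 1.\<close>
    define g where "g = c + b + 3/2 + x"
    define h where "h = c + b + x + 1/2"
    define B where "B = 2 * c + 2 * b + 2 + x"
    define A where "A = (2 * c + x) * (2 * b + x) * (c + b + x)"
    \<comment> \<open>With \<open>r\<close> as common factor, \<open>T n\<close> and
      \<open>T (Suc n)\<close> become polynomial expressions and the recurrences reduce to
      polynomial identities.\<close>
    define r where "r = T n / (g * B * (x + 1))"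
    have nz: "g \<noteq> 0" "B \<noteq> 0" "x + 1 \<noteq> 0"
      using assms(1,2)[of "Suc n"] of_nat_neq_0[of n, where 'a='a]
      by (auto simp: g_def B_def x_def pochhammer_Suc add_ac)
    have h: "2 * h = 2 * c + 2 * b + 2 * x + 1"
      by (simp add: h_def field_simps)
    have T: "T n = r * (g * B * (x + 1))"
      using nz by (simp add: r_def)
    have T': "T (Suc n) = r * A"
    proof -
      have "T (Suc n) = T n * (A / (g * B * (x + 1)))"
        by (simp add: T_def fps_hypergeo_def pochhammer_Suc A_def B_def g_def x_def add_ac mult_ac)
      then show ?thesis
        by (simp add: r_def)
    qed
    \<comment> \<open>What remains of the recurrence for \<open>w\<close> after cancelling
      \<open>b * c * x * T n\<close>; writing out \<open>2 * h\<close> avoids the fraction in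
      \<open>h\<close>. Likewise \<open>key_u\<close> for \<open>u\<close>, with the new value of
      \<open>w\<close> inserted.\<close>
    have key_w: "2 * A = (x + 2 * (c + b)) * (x - 1) * (2 * c + 2 * b + 2 * x + 1) + Q x"
      unfolding A_def Q_def by algebra
    have key_u: "A * Q (x + 1) = B * (((c + b + x) * x + 2 * b * c) * Q x -
        2 * c * b * x * (x - 1) * (2 * c + 2 * b + 2 * x + 1)) + 4 * c * b * x * A"
      unfolding A_def B_def Q_def by algebra
    have IHu: "Q 0 * u n = T n * Q x" and IHw: "Q 0 * w n = T n * (2 * c * b * x * (x - 1) * h)"
      using Suc.IH by (simp_all add: x_def h_def)
    have "B * w (Suc n) = (x + 2 * (c + b)) * w n + b * c * x * u n"
      using rec(1)[of n] by (simp add: x_def B_def algebra_simps)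
    then have "B * (Q 0 * w (Suc n)) = (x + 2 * (c + b)) * (Q 0 * w n) + b * c * x * (Q 0 * u n)"
      by algebra
    also have "\<dots> = B * (T (Suc n) * (2 * c * b * (x + 1) * x * g))"
      unfolding IHu IHw T T' using key_w[folded h] by algebra
    finally have w: "Q 0 * w (Suc n) = T (Suc n) * (2 * c * b * (x + 1) * x * g)"
      using nz(2) by simp
    have "g * (x + 1) * u (Suc n) = (x + (c + b)) * x * u n + 2 * (w (Suc n) - w n + b * c * u n)"
      using rec(2)[of n] by (simp add: x_def g_def add_ac)
    then have "g * (x + 1) * (Q 0 * u (Suc n)) =
        (x + (c + b)) * x * (Q 0 * u n) + 2 * (Q 0 * w (Suc n) - Q 0 * w n + b * c * (Q 0 * u n))"
      by algebra
    also have "\<dots> = g * (x + 1) * (T (Suc n) * Q (x + 1))"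
      unfolding IHu IHw w unfolding T T' using key_u[folded h] by algebra
    finally have "Q 0 * u (Suc n) = T (Suc n) * Q (x + 1)"
      using nz by simp
    with w show ?case
      by (simp add: x_def g_def add_ac)
  qed
  then show "Q 0 * fps_nth (F\<^sup>2) n = T n * Q (of_nat n)"
    and "Q 0 * fps_nth ((fps_theta F)\<^sup>2) n =
      T n * (2 * c * b * of_nat n * (of_nat n - 1) * (c + b + of_nat n + 1/2))"
    by (simp_all add: u_def w_def)
qed

lemma pochhammer_add_1: "a * pochhammer (a + 1) n = pochhammer a n * (a + of_nat n)"
  for a :: "'a::comm_semiring_1"
  by (metis pochhammer_Suc pochhammer_rec)

theorem corollary3:
  fixes b c f l1 l2 l3 :: complex
  assumes "degree (P3 b c f) = 3"
    and "proots (P3 b c f) = {#l1, l2, l3#}"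
    and "hypergeo_defined [c + b + 3/2, f]"
    and "hypergeo_defined [c + b + 3/2, 2*c + 2*b + 2, l1, l2, l3]"
  shows "(fps_hypergeo [c, b, f + 1] [c + b + 3/2, f] 1)^2 =
    fps_hypergeo [2*c, 2*b, c + b, l1 + 1, l2 + 1, l3 + 1]
                 [c + b + 3/2, 2*c + 2*b + 2, l1, l2, l3] 1"
proof (rule fps_ext)
  fix n
  define F where "F = fps_hypergeo [b, c] [c + b + 3/2] 1"
  define T where "T = fps_nth (fps_hypergeo [2 * c, 2 * b, c + b] [c + b + 3/2, 2 * c + 2 * b + 2] 1)"
  define Q where "Q = (\<lambda>n. n\<^sup>2 + (8 * c * b + 4 * c + 4 * b + 1) * n + 2 * (2 * c + 1) * (2 * b + 1) * (c + b))"
  have poch: "pochhammer a k \<noteq> 0" if "a \<in> {c + b + 3/2, 2*c + 2*b + 2, l1, l2, l3, f}" for a k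
    using assms(3,4) that by (auto simp: hypergeo_defined_def)
  have nz: "f \<noteq> 0" "l1 \<noteq> 0" "l2 \<noteq> 0" "l3 \<noteq> 0"
    using poch[of f 1] poch[of l1 1] poch[of l2 1] poch[of l3 1] by auto
  have ratio: "pochhammer (a + 1) k = pochhammer a k * (a + of_nat k) / a" if "a \<noteq> 0" for a :: complex and k
    using that pochhammer_add_1[of a k] by (simp add: field_simps)
  define a where "a = lead_coeff (P3 b c f)"
  have "a \<noteq> 0"
    using assms(1) unfolding a_def leading_coeff_0_iff by auto
  have P3: "poly (P3 b c f) t = a * ((t - l1) * (t - l2) * (t - l3))" for t
  proof -
    have "P3 b c f = smult a (\<Prod>x\<in>#{#l1, l2, l3#}. [:- x, 1:])"
      by (simp only: a_def complex_poly_decompose_multiset flip: assms(2))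
    then show ?thesis
      by (simp add: algebra_simps)
  qed
  \<comment> \<open>Evaluation at \<open>t = 0\<close>. As no root vanishes, this makes
    \<open>Q 0\<close> nonzero and allows cancelling it at the end.\<close>
  have P0: "f\<^sup>2 * Q 0 = - a * (l1 * l2 * l3)"
    using P3[of 0] by (simp add: poly_P3 Q_def power2_eq_square)
  then have Q0: "Q 0 \<noteq> 0"
    using nz \<open>a \<noteq> 0\<close> by auto
  have lhs: "fps_hypergeo [c, b, f + 1] [c + b + 3/2, f] 1 = F + fps_const (1 / f) * fps_theta F"
  proof (rule fps_ext)
    fix k
    show "fps_nth (fps_hypergeo [c, b, f + 1] [c + b + 3/2, f] 1) k =
        fps_nth (F + fps_const (1 / f) * fps_theta F) k"
      using nz(1) poch[of f k] by (simp add: F_def fps_hypergeo_def ratio add_divide_distrib distrib_left mult_ac)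
  qed
  \<comment> \<open>The cross term of the square is a \<open>\<theta>\<close>-derivative, so only
    coefficients of \<open>F\<^sup>2\<close> and \<open>(\<theta> F)\<^sup>2\<close> enter.\<close>
  have "fps_theta (F\<^sup>2) = 2 * (F * fps_theta F)"
    by (simp add: power2_eq_square fps_theta_mult)
  moreover have "fps_const (1 / f) * fps_const (1 / f) = fps_const (1 / f\<^sup>2)"
    by (simp add: power2_eq_square)
  ultimately have "(F + fps_const (1 / f) * fps_theta F)\<^sup>2 =
      F\<^sup>2 + fps_const (1 / f) * fps_theta (F\<^sup>2) + fps_const (1 / f\<^sup>2) * (fps_theta F)\<^sup>2"
    by algebra
  then have sq: "fps_nth ((F + fps_const (1 / f) * fps_theta F)\<^sup>2) n = fps_nth (F\<^sup>2) n +
      1 / f * (of_nat n * fps_nth (F\<^sup>2) n) + 1 / f\<^sup>2 * fps_nth ((fps_theta F)\<^sup>2) n"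
    by simp
  have "f\<^sup>2 * (Q 0 * fps_nth ((fps_hypergeo [c, b, f + 1] [c + b + 3/2, f] 1)\<^sup>2) n) =
      f * (f + of_nat n) * (Q 0 * fps_nth (F\<^sup>2) n) + Q 0 * fps_nth ((fps_theta F)\<^sup>2) n"
    unfolding lhs sq using nz(1) by (simp add: field_simps power2_eq_square[of f])
  also have "\<dots> = T n * poly (P3 b c f) (- of_nat n)"
    unfolding F_def T_def Q_def poly_P3
    by (subst hypergeo_2F1_squares, (rule poch; simp)+)+ (simp, algebra)
  \<comment> \<open>The factorisation at \<open>-n\<close> gives \<open>- a\<close> times the
    product of the \<open>\<lambda> + n\<close>; by \<open>P0\<close> the quotient by
    \<open>f\<^sup>2 * Q 0\<close> is the product of the \<open>(\<lambda> + n) / \<lambda>\<close>,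
    the contribution of the pairs \<open>\<lambda> + 1\<close>, \<open>\<lambda>\<close>.\<close>
  also have "\<dots> = f\<^sup>2 * Q 0 * (T n * ((l1 + of_nat n) / l1 * ((l2 + of_nat n) / l2) * ((l3 + of_nat n) / l3)))"
    unfolding P3 P0 using nz by (simp add: field_simps)
  also have "T n * ((l1 + of_nat n) / l1 * ((l2 + of_nat n) / l2) * ((l3 + of_nat n) / l3)) =
      fps_nth (fps_hypergeo [2*c, 2*b, c + b, l1 + 1, l2 + 1, l3 + 1]
                 [c + b + 3/2, 2*c + 2*b + 2, l1, l2, l3] 1) n"
    using nz poch[of l1 n] poch[of l2 n] poch[of l3 n]
    by (simp add: T_def fps_hypergeo_def ratio mult_ac)
  finally show "fps_nth ((fps_hypergeo [c, b, f + 1] [c + b + 3/2, f] 1)\<^sup>2) n =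
      fps_nth (fps_hypergeo [2*c, 2*b, c + b, l1 + 1, l2 + 1, l3 + 1]
                 [c + b + 3/2, 2*c + 2*b + 2, l1, l2, l3] 1) n"
    using nz(1) Q0 by (simp only: mult.assoc mult_cancel_left power_eq_0_iff) auto
qed

end
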